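(* Suppose that for every prime $q$ the following holds: for every finite solvable group $G$ of characteristic $q$, and all subgroups $H, K \leq G$ such that $H$ is maximal in $G$ and $K \cong H$, the subgroup $K$ is maximal in $G$. Then for every finite solvable group $G$, and all subgroups $H, K \leq G$ such that $H$ is maximal in $G$ and $K\cong H$, the subgroup $K$ is maximal in $G$.
   Context: For a prime $q$ and a finite group $G$, $O_q(G)$ denotes the largest normal $q$-subgroup of $G$. A finite group $G$ is said to be of characteristic $q$ if $C_G(O_q(G)) \leq O_q(G)$. *)

theory Defs
  imports "HOL-Algebra.Algebra" "HOL-Computational_Algebra.Primes"
begin

definition maximal_subgroup :: "'a set \<Rightarrow> ('a, 'b) monoid_scheme \<Rightarrow> bool" where
  "maximal_subgroup H G \<longleftrightarrow> subgroup H G \<and> H \<noteq> carrier G \<and>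
     (\<forall>L. subgroup L G \<and> H \<subseteq> L \<longrightarrow> L = H \<or> L = carrier G)"

definition centralizer :: "('a, 'b) monoid_scheme \<Rightarrow> 'a set \<Rightarrow> 'a set" where
  "centralizer G S = {x \<in> carrier G. \<forall>s\<in>S. x \<otimes>\<^bsub>G\<^esub> s = s \<otimes>\<^bsub>G\<^esub> x}"

definition normal_q_subgroup :: "nat \<Rightarrow> 'a set \<Rightarrow> ('a, 'b) monoid_scheme \<Rightarrow> bool" where
  "normal_q_subgroup q N G \<longleftrightarrow> N \<lhd> G \<and> (\<exists>n. card N = q ^ n)"

(* Largest with respect to inclusion. It exists when G is finite and q is prime:
   see normal_q_subgroup_q_core below. *)
definition q_core :: "nat \<Rightarrow> ('a, 'b) monoid_scheme \<Rightarrow> 'a set" where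
  "q_core q G = (GREATEST N. normal_q_subgroup q N G)"

definition of_characteristic :: "nat \<Rightarrow> ('a, 'b) monoid_scheme \<Rightarrow> bool" where
  "of_characteristic q G \<longleftrightarrow> centralizer G (q_core q G) \<subseteq> q_core q G"

lemma normal_q_subgroup_set_mult:
  fixes G (structure)
  assumes "group G" and fin: "finite (carrier G)" and q: "Factorial_Ring.prime q"
    and M: "normal_q_subgroup q M G" and N: "normal_q_subgroup q N G"
  shows "normal_q_subgroup q (M <#> N) G"
proof -
  interpret group G by fact
  have nM: "M \<lhd> G" and nN: "N \<lhd> G"
    using M N by (auto simp: normal_q_subgroup_def)
  have sM: "subgroup M G" and sN: "subgroup N G"
    using nM nN by (auto simp: normal_def)
  obtain m n where mn: "card M = q ^ m" "card N = q ^ n"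
    using M N by (auto simp: normal_q_subgroup_def)
  interpret sis: second_isomorphism_grp M G N
    using nM sN by (simp add: second_isomorphism_grp_def second_isomorphism_grp_axioms_def)
  let ?P = "M <#> N"
  have nP: "?P \<lhd> G"
    using nM nN by (rule normal_subgroup_set_mult_closed)
  then have sP: "subgroup ?P G"
    by (simp add: normal_def)
  interpret gN: group "G\<lparr>carrier := N\<rparr>"
    using sN by (rule subgroup_imp_group)
  interpret gP: group "G\<lparr>carrier := ?P\<rparr>"
    using sP by (rule subgroup_imp_group)
  have "card (rcosets\<^bsub>G\<lparr>carrier := N\<rparr>\<^esub> (N \<inter> M)) = card (rcosets\<^bsub>G\<lparr>carrier := ?P\<rparr>\<^esub> M)"
    using sis.normal_intersection_quotient_isom
    by (auto simp: iso_def FactGroup_def Int_commute dest!: bij_betw_same_card)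
  moreover have "card (rcosets\<^bsub>G\<lparr>carrier := N\<rparr>\<^esub> (N \<inter> M)) * card (N \<inter> M) = card N"
    using gN.lagrange[OF normal_imp_subgroup[OF sis.normal_subgrp_intersection_normal]]
    by (simp add: order_def)
  moreover have "card (rcosets\<^bsub>G\<lparr>carrier := ?P\<rparr>\<^esub> M) * card M = card ?P"
    using gP.lagrange[of M] subgroup_incl[OF sM sP sis.H_contained_in_set_mult]
    by (simp add: order_def)
  ultimately obtain k where "card ?P = k * q ^ m" and "k dvd q ^ n"
    using mn by (metis dvd_triv_left)
  then have "\<exists>l. card ?P = q ^ l"
    using q by (metis divides_primepow_nat power_add)
  with nP show ?thesis
    by (simp add: normal_q_subgroup_def)
qed

lemma normal_q_subgroup_q_core:
  fixes G (structure)
  assumes "group G" and "finite (carrier G)" and "Factorial_Ring.prime q"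
  shows "normal_q_subgroup q (q_core q G) G"
    and "normal_q_subgroup q N G \<Longrightarrow> N \<subseteq> q_core q G"
proof -
  interpret group G by fact
  let ?S = "{N. normal_q_subgroup q N G}"
  have "?S \<subseteq> Pow (carrier G)"
    by (auto simp: normal_q_subgroup_def dest: normal_imp_subgroup subgroup.subset)
  then have fin: "finite ?S"
    using assms(2) by (meson finite_Pow_iff finite_subset)
  have "normal_q_subgroup q {\<one>} G"
    using one_is_normal by (auto simp: normal_q_subgroup_def intro: exI[of _ 0])
  then obtain M where M: "normal_q_subgroup q M G"
    and max: "\<And>N. normal_q_subgroup q N G \<Longrightarrow> M \<subseteq> N \<Longrightarrow> M = N"
    using finite_has_maximal[OF fin] by auto
  have greatest: "N \<subseteq> M" if N: "normal_q_subgroup q N G" for N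
  proof -
    have sg: "second_isomorphism_grp M G N"
      using M N by (simp add: normal_q_subgroup_def second_isomorphism_grp_def
          second_isomorphism_grp_axioms_def normal_imp_subgroup)
    have "M = M <#> N"
      using max normal_q_subgroup_set_mult[OF assms M N]
        second_isomorphism_grp.H_contained_in_set_mult[OF sg] by blast
    then show ?thesis
      using second_isomorphism_grp.S_contained_in_set_mult[OF sg] by simp
  qed
  have eq: "q_core q G = M"
    unfolding q_core_def using M greatest by (intro Greatest_equality) auto
  show "normal_q_subgroup q (q_core q G) G"
    using M eq by simp
  show "N \<subseteq> q_core q G" if "normal_q_subgroup q N G"
    using greatest[OF that] eq by simp
qed

end

theory Submission
  imports Defs
begin

text \<open>
  The reduction embeds the problem for an arbitrary finite solvable group \<open>G\<close> into a solvable
  group of characteristic 2, the regular wreath product \<open>P\<close> of the cyclic group of order 2 with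
  \<open>G\<close>. Its base group \<open>W\<close>, the power set of \<open>G\<close> under symmetric difference, is a normal 2-subgroup
  on which \<open>G\<close> acts faithfully by left translation. So \<open>W\<close> contains its own centralizer, and
  therefore so does the larger normal subgroup \<open>O\<^sub>2(P)\<close>
  (\<open>of_characteristicI\<close>, \<open>of_characteristic_C2_wreath\<close>).

  Taking preimages under the projection of \<open>P\<close> onto \<open>G\<close> preserves and reflects maximality
  (\<open>maximal_subgroup_vimage_iff\<close>), so it is enough to see that isomorphic subgroups \<open>H\<close> and \<open>K\<close>
  of \<open>G\<close> have isomorphic preimages \<open>W H\<close> and \<open>W K\<close>. As an \<open>H\<close>-set under left translation, \<open>G\<close> is
  a disjoint union of \<open>[G : H]\<close> copies of the regular \<open>H\<close>-set, and likewise for \<open>K\<close>. Since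
  \<open>[G : H] = [G : K]\<close>, every isomorphism \<open>\<phi>\<close> from \<open>H\<close> to \<open>K\<close> has a permutation \<open>f\<close> of \<open>G\<close>
  with \<open>f (h x) = \<phi> h (f x)\<close> (\<open>ex_equivariant_bij\<close>). Then \<open>(A, h) \<mapsto> (f ` A, \<phi> h)\<close> is an
  isomorphism from \<open>W H\<close> to \<open>W K\<close> (\<open>C2_wreath_vimage_iso\<close>).

  A finite group is isomorphic to a group of natural numbers, so the hypothesis, which
  concerns groups of natural numbers, applies to \<open>P\<close> (\<open>nat_groups_suffice\<close>).
\<close>

section \<open>Subgroups, characteristic and solvability\<close>

lemma (in group_hom) subgroup_vimage:
  assumes "subgroup S H"
  shows "subgroup {x \<in> carrier G. h x \<in> S} G"
proof -
  interpret S: subgroup S H by fact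
  show ?thesis
    by (rule G.subgroupI) (auto intro: exI[of _ "\<one>"])
qed

text \<open>Preimage and image are inverse to each other between the subgroups of \<open>H\<close> and the subgroups
  of \<open>G\<close> containing the kernel. A subgroup above a preimage contains the kernel, so chains above
  \<open>S\<close> and above its preimage correspond.\<close>

lemma (in group_hom) maximal_subgroup_vimage_iff:
  assumes surj: "h ` carrier G = carrier H" and S: "subgroup S H"
  shows "maximal_subgroup {x \<in> carrier G. h x \<in> S} G \<longleftrightarrow> maximal_subgroup S H"
proof -
  let ?v = "\<lambda>S. {x \<in> carrier G. h x \<in> S}"
  have img_v: "h ` ?v T = T" if "subgroup T H" for T
    using surj subgroup.subset[OF that] by auto
  have v_img: "?v (h ` L) = L" if L: "subgroup L G" and le: "?v S \<subseteq> L" for L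
  proof
    show "?v (h ` L) \<subseteq> L"
    proof
      fix x assume "x \<in> ?v (h ` L)"
      then obtain y where x: "x \<in> carrier G" and y: "y \<in> L" and eq: "h x = h y" by auto
      have yG: "y \<in> carrier G" using L y by (rule subgroup.mem_carrier)
      have "h (x \<otimes> inv y) = \<one>\<^bsub>H\<^esub>"
        using x yG eq by simp
      then have "x \<otimes> inv y \<in> L"
        using le x yG subgroup.one_closed[OF S] by auto
      then have "x \<otimes> inv y \<otimes> y \<in> L"
        using L y by (simp add: subgroup.m_closed)
      then show "x \<in> L" using x yG by (simp add: G.m_assoc)
    qed
    show "L \<subseteq> ?v (h ` L)" using subgroup.subset[OF L] by auto
  qed
  have v_carrier: "?v (carrier H) = carrier G" by auto
  show ?thesis
  proof
    assume m: "maximal_subgroup (?v S) G"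
    have "T = S \<or> T = carrier H" if T: "subgroup T H" "S \<subseteq> T" for T
    proof -
      have "?v T = ?v S \<or> ?v T = carrier G"
        using m subgroup_vimage[OF T(1)] T(2) unfolding maximal_subgroup_def by blast
      then have "h ` ?v T = h ` ?v S \<or> h ` ?v T = h ` carrier G"
        by (elim disjE) (simp_all only: simp_thms)
      then show ?thesis
        unfolding img_v[OF T(1)] img_v[OF S] surj .
    qed
    moreover have "S \<noteq> carrier H"
      using m v_carrier unfolding maximal_subgroup_def by auto
    ultimately show "maximal_subgroup S H"
      using S unfolding maximal_subgroup_def by blast
  next
    assume m: "maximal_subgroup S H"
    have "L = ?v S \<or> L = carrier G" if L: "subgroup L G" "?v S \<subseteq> L" for L
    proof -
      have "S \<subseteq> h ` L" using img_v[OF S] L(2) by blast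
      then have "h ` L = S \<or> h ` L = carrier H"
        using m subgroup_img_is_subgroup[OF L(1)] unfolding maximal_subgroup_def by blast
      then have "?v (h ` L) = ?v S \<or> ?v (h ` L) = ?v (carrier H)"
        by (elim disjE) (simp_all only: simp_thms)
      then show ?thesis
        unfolding v_img[OF L] v_carrier .
    qed
    moreover have "?v S \<noteq> carrier G"
    proof
      assume "?v S = carrier G"
      then have "h ` ?v S = h ` carrier G" by (rule arg_cong)
      then have "S = carrier H" unfolding img_v[OF S] surj .
      then show False using m by (simp add: maximal_subgroup_def)
    qed
    ultimately show "maximal_subgroup (?v S) G"
      using subgroup_vimage[OF S] unfolding maximal_subgroup_def by blast
  qed
qed

text \<open>Centralizers reverse inclusion, so any self-centralizing normal \<open>q\<close>-subgroup passes the
  defining property on to the \<open>q\<close>-core above it.\<close>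

lemma of_characteristicI:
  assumes "group G" "finite (carrier G)" "Factorial_Ring.prime q"
    and "normal_q_subgroup q N G" and "centralizer G N \<subseteq> N"
  shows "of_characteristic q G"
proof -
  have "N \<subseteq> q_core q G"
    using assms by (intro normal_q_subgroup_q_core(2))
  moreover from this have "centralizer G (q_core q G) \<subseteq> centralizer G N"
    by (auto simp: centralizer_def)
  ultimately show ?thesis
    using assms(5) unfolding of_characteristic_def by blast
qed

lemma of_characteristic_iso:
  assumes f: "f \<in> iso G H" and G: "group G" and H: "group H"
    and fin: "finite (carrier G)" and q: "Factorial_Ring.prime q" and char: "of_characteristic q G"
  shows "of_characteristic q H"
proof -
  let ?N = "q_core q G"
  interpret group_hom G H f
    using f G H by (simp add: group_hom_def group_hom_axioms_def iso_def)
  have inj: "inj_on f (carrier G)" and surj: "f ` carrier G = carrier H"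
    using f by (auto simp: iso_def bij_betw_def)
  have N: "normal_q_subgroup q ?N G"
    using G fin q by (rule normal_q_subgroup_q_core)
  then have subset: "?N \<subseteq> carrier G"
    by (auto simp: normal_q_subgroup_def dest: normal_imp_subgroup subgroup.subset)
  have "card (f ` ?N) = card ?N"
    using inj subset by (meson card_image inj_on_subset)
  then have "normal_q_subgroup q (f ` ?N) H"
    using N iso_normal_subgroup[OF f G H] by (simp add: normal_q_subgroup_def)
  moreover have "centralizer H (f ` ?N) \<subseteq> f ` ?N"
  proof
    fix y assume y: "y \<in> centralizer H (f ` ?N)"
    then obtain x where x: "x \<in> carrier G" "y = f x"
      using surj by (auto simp: centralizer_def)
    have "x \<otimes>\<^bsub>G\<^esub> s = s \<otimes>\<^bsub>G\<^esub> x" if "s \<in> ?N" for s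
    proof (rule inj_onD[OF inj])
      show "f (x \<otimes>\<^bsub>G\<^esub> s) = f (s \<otimes>\<^bsub>G\<^esub> x)"
        using that x y subset by (auto simp: centralizer_def subset_iff)
    qed (use that x subset in auto)
    then have "x \<in> ?N"
      using x char by (auto simp: of_characteristic_def centralizer_def)
    then show "y \<in> f ` ?N" using x by simp
  qed
  moreover have "finite (carrier H)" using fin surj by (metis finite_imageI)
  ultimately show ?thesis
    using of_characteristicI[OF H _ q] by blast
qed

lemma (in comm_group) comm_group_imp_solvable: "solvable G"
  using derived_eq_singleton[of "carrier G"]
  by (auto simp: solvable_iff_trivial_derived_seq intro: exI[of _ "1::nat"])

lemma iso_restrict:
  assumes "f \<in> iso G H" and "S \<subseteq> carrier G"
  shows "f \<in> iso (G\<lparr>carrier := S\<rparr>) (H\<lparr>carrier := f ` S\<rparr>)"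
  using assms by (auto simp: iso_def hom_def bij_betw_def subset_iff intro: inj_on_subset)

section \<open>The choice of the underlying type\<close>

text \<open>A finite carrier injects into the natural numbers. Transporting the group structure along
  the injection keeps every notion involved, since all of them are invariant under
  isomorphism.\<close>

lemma nat_groups_suffice:
  fixes G :: "'b monoid"
  assumes nat: "\<And>G :: nat monoid. \<And>H K. \<lbrakk>group G; finite (carrier G); solvable G; of_characteristic q G;
        maximal_subgroup H G; subgroup K G; G\<lparr>carrier := K\<rparr> \<cong> G\<lparr>carrier := H\<rparr>\<rbrakk> \<Longrightarrow> maximal_subgroup K G"
    and q: "Factorial_Ring.prime q"
    and G: "group G" "finite (carrier G)" "solvable G" "of_characteristic q G"
    and H: "maximal_subgroup H G" and K: "subgroup K G"
    and iso: "G\<lparr>carrier := K\<rparr> \<cong> G\<lparr>carrier := H\<rparr>"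
  shows "maximal_subgroup K G"
proof -
  interpret group G by fact
  obtain e :: "'b \<Rightarrow> nat" where e: "inj_on e (carrier G)"
    using finite_imp_inj_to_nat_seg[OF G(2)] by blast
  let ?N = "image_group e G"
  have N: "group ?N" using inj_imp_image_group_is_group[OF e] .
  have e_iso: "e \<in> iso G ?N" using inj_imp_image_group_iso[OF e] .
  have cN: "carrier ?N = e ` carrier G" by (rule image_group_carrier)
  interpret e: group_hom G ?N e
    using N e_iso by (simp add: group_hom_def group_hom_axioms_def iso_def group_axioms)
  have sH: "subgroup H G" using H by (simp add: maximal_subgroup_def)
  have vimage: "{x \<in> carrier G. e x \<in> e ` S} = S" if "subgroup S G" for S
    using inj_on_image_mem_iff[OF e _ subgroup.subset[OF that]] subgroup.subset[OF that] by auto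
  have max_iff: "maximal_subgroup (e ` S) ?N \<longleftrightarrow> maximal_subgroup S G" if S: "subgroup S G" for S
    using e.maximal_subgroup_vimage_iff[OF cN[symmetric] e.subgroup_img_is_subgroup[OF S]]
    by (simp add: vimage[OF S])
  have restrict: "G\<lparr>carrier := S\<rparr> \<cong> ?N\<lparr>carrier := e ` S\<rparr>" if "subgroup S G" for S
    using iso_restrict[OF e_iso subgroup.subset[OF that]] by (auto simp: is_iso_def)
  have "?N\<lparr>carrier := e ` K\<rparr> \<cong> G\<lparr>carrier := K\<rparr>"
    using group.iso_sym[OF subgroup_imp_group[OF K] restrict[OF K]] .
  also note iso
  also note restrict[OF sH]
  finally have iso_N: "?N\<lparr>carrier := e ` K\<rparr> \<cong> ?N\<lparr>carrier := e ` H\<rparr>" .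
  have "solvable ?N"
    using e.solvable_imp_solvable_img[of "carrier G"] G(3) cN by (simp add: solvable_def)
  moreover have "of_characteristic q ?N"
    using of_characteristic_iso[OF e_iso G(1) N G(2) q G(4)] .
  ultimately have "maximal_subgroup (e ` K) ?N"
    using nat[OF N _ _ _ _ _ iso_N] G(2) cN max_iff[OF sH] H e.subgroup_img_is_subgroup[OF K] by simp
  then show ?thesis using max_iff[OF K] by simp
qed

section \<open>Permutations equivariant along an isomorphism of subgroups\<close>

text \<open>Left translation by \<open>H\<close> permutes each right coset \<open>H x\<close> regularly, and \<open>G\<close> has equally many
  right cosets of \<open>H\<close> and of \<open>K\<close>. After a matching \<open>\<beta>\<close> of the cosets and a choice of
  representatives, the map sends \<open>h r\<close> to \<open>\<phi> h r'\<close>, where \<open>r\<close> and \<open>r'\<close> represent matching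
  cosets.\<close>

lemma (in group) ex_equivariant_bij:
  assumes fin: "finite (carrier G)" and H: "subgroup H G" and K: "subgroup K G"
    and \<phi>: "\<phi> \<in> iso (G\<lparr>carrier := H\<rparr>) (G\<lparr>carrier := K\<rparr>)"
  shows "\<exists>f. bij_betw f (carrier G) (carrier G) \<and>
    (\<forall>h\<in>H. \<forall>x\<in>carrier G. f (h \<otimes> x) = \<phi> h \<otimes> f x)"
proof -
  have \<phi>_mult: "\<phi> (a \<otimes> b) = \<phi> a \<otimes> \<phi> b" if "a \<in> H" "b \<in> H" for a b
    using \<phi> that by (auto simp: iso_def hom_def)
  have \<phi>_bij: "bij_betw \<phi> H K" using \<phi> by (simp add: iso_def)
  have \<phi>_in: "\<phi> a \<in> K" if "a \<in> H" for a using \<phi>_bij that by (rule bij_betwE[rule_format])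
  have HG: "a \<in> carrier G" if "a \<in> H" for a using H that by (rule subgroup.mem_carrier)
  have KG: "a \<in> carrier G" if "a \<in> K" for a using K that by (rule subgroup.mem_carrier)
  have "card H = card K" using \<phi>_bij by (rule bij_betw_same_card)
  moreover have "card H > 0"
    using H fin finite_subset[OF subgroup.subset[OF H] fin] subgroup.one_closed[OF H]
    by (auto simp: card_gt_0_iff)
  ultimately have "card (rcosets H) = card (rcosets K)"
    using lagrange[OF H] lagrange[OF K] by (metis mult_right_cancel not_gr_zero)
  moreover have "finite (rcosets H)" "finite (rcosets K)"
    using fin rcosets_subset_PowG[OF H] rcosets_subset_PowG[OF K]
    by (meson finite_Pow_iff finite_subset)+
  ultimately obtain \<beta> where \<beta>: "bij_betw \<beta> (rcosets H) (rcosets K)"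
    by (metis finite_same_card_bij)
  define r where "r C = (SOME x. x \<in> C)" for C :: "'a set"
  have r: "r C \<in> C \<and> r C \<in> carrier G" if C: "C \<in> rcosets S" and S: "subgroup S G" for C S
  proof -
    have "C \<noteq> {}" using C S rcos_self by (auto simp: RCOSETS_def)
    then have "r C \<in> C" unfolding r_def by (simp add: some_in_eq)
    then show ?thesis using C S rcosets_subset_PowG by blast
  qed
  have coset_in: "H #> x \<in> rcosets H" if "x \<in> carrier G" for x
    using H that by (simp add: rcosetsI subgroup.subset)
  have \<beta>_in: "\<beta> (H #> x) \<in> rcosets K" if "x \<in> carrier G" for x
    using \<beta> coset_in[OF that] by (auto simp: bij_betw_def)
  have rH: "r (H #> x) \<in> carrier G" "x \<otimes> inv (r (H #> x)) \<in> H" if x: "x \<in> carrier G" for x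
  proof -
    show rG: "r (H #> x) \<in> carrier G" using r[OF coset_in[OF x] H] by simp
    have "H #> x = H #> r (H #> x)"
      using r[OF coset_in[OF x] H] x H by (intro repr_independence) auto
    then have "x \<in> H #> r (H #> x)" using rcos_self[OF x H] by simp
    then show "x \<otimes> inv (r (H #> x)) \<in> H"
      using subgroup.rcos_module_imp[OF H is_group rG] by simp
  qed
  have rK: "r (\<beta> (H #> x)) \<in> carrier G" if "x \<in> carrier G" for x
    using r[OF \<beta>_in[OF that] K] by simp
  define f where "f x = \<phi> (x \<otimes> inv (r (H #> x))) \<otimes> r (\<beta> (H #> x))" for x
  have f_in: "f x \<in> carrier G" if "x \<in> carrier G" for x
    unfolding f_def using \<phi>_in rH(2) rK KG that by simp
  have f_coset: "K #> f x = \<beta> (H #> x)" if x: "x \<in> carrier G" for x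
  proof -
    obtain y where y: "y \<in> carrier G" "\<beta> (H #> x) = K #> y"
      using \<beta>_in[OF x] by (auto simp: RCOSETS_def)
    have "r (\<beta> (H #> x)) \<in> K #> y" using r[OF \<beta>_in[OF x] K] y by simp
    then have "K #> y = K #> r (\<beta> (H #> x))" using y K by (intro repr_independence)
    moreover have "f x \<in> K #> r (\<beta> (H #> x))"
      unfolding f_def using \<phi>_in[OF rH(2)[OF x]] by (auto simp: r_coset_def)
    then have "K #> r (\<beta> (H #> x)) = K #> f x" using rK[OF x] K by (intro repr_independence)
    ultimately show ?thesis using y by simp
  qed
  have inj: "inj_on f (carrier G)"
  proof (rule inj_onI)
    fix x y assume x: "x \<in> carrier G" and y: "y \<in> carrier G" and eq: "f x = f y"
    have "\<beta> (H #> x) = \<beta> (H #> y)" using f_coset[OF x] f_coset[OF y] eq by simp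
    then have same: "H #> x = H #> y"
      using \<beta> coset_in x y by (meson bij_betw_def inj_onD)
    then have "\<phi> (x \<otimes> inv (r (H #> x))) = \<phi> (y \<otimes> inv (r (H #> x)))"
      using eq x y rK[OF x] rH(2)[OF x] rH(2)[OF y] \<phi>_in KG unfolding f_def by simp
    then have "x \<otimes> inv (r (H #> x)) = y \<otimes> inv (r (H #> x))"
      using \<phi>_bij rH(2)[OF x] rH(2)[OF y] same by (metis bij_betw_def inj_onD)
    then show "x = y" using x y rH(1)[OF x] by simp
  qed
  have "bij_betw f (carrier G) (carrier G)"
    using inj f_in fin by (auto simp: bij_betw_def endo_inj_surj image_subset_iff)
  moreover have "f (h \<otimes> x) = \<phi> h \<otimes> f x" if h: "h \<in> H" and x: "x \<in> carrier G" for h x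
  proof -
    have "h \<otimes> x \<in> H #> x" using h by (auto simp: r_coset_def)
    then have same: "H #> (h \<otimes> x) = H #> x" using x H by (metis repr_independence)
    have "f (h \<otimes> x) = \<phi> (h \<otimes> (x \<otimes> inv (r (H #> x)))) \<otimes> r (\<beta> (H #> x))"
      unfolding f_def same using h x rH(1)[OF x] HG by (simp add: m_assoc)
    also have "\<dots> = \<phi> h \<otimes> f x"
      unfolding f_def using h rH(2)[OF x] rK[OF x] \<phi>_mult \<phi>_in KG by (simp add: m_assoc)
    finally show ?thesis .
  qed
  ultimately show ?thesis by blast
qed

section \<open>The regular wreath product with the cyclic group of order two\<close>

text \<open>A subset \<open>A\<close> of \<open>G\<close> stands for its indicator function with values in the field of two
  elements, so that symmetric difference is pointwise addition and left translation is the
  regular action.\<close>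

definition C2_wreath :: "('a, 'b) monoid_scheme \<Rightarrow> ('a set \<times> 'a) monoid" where
  "C2_wreath G = \<lparr>carrier = Pow (carrier G) \<times> carrier G,
     monoid.mult = (\<lambda>(A, x) (B, y). (sym_diff A (x <#\<^bsub>G\<^esub> B), x \<otimes>\<^bsub>G\<^esub> y)),
     one = ({}, \<one>\<^bsub>G\<^esub>)\<rparr>"

lemma C2_wreath_simps [simp]:
  "carrier (C2_wreath G) = Pow (carrier G) \<times> carrier G"
  "(A, x) \<otimes>\<^bsub>C2_wreath G\<^esub> (B, y) = (sym_diff A (x <#\<^bsub>G\<^esub> B), x \<otimes>\<^bsub>G\<^esub> y)"
  "\<one>\<^bsub>C2_wreath G\<^esub> = ({}, \<one>\<^bsub>G\<^esub>)"
  by (simp_all add: C2_wreath_def)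

context group
begin

lemma l_coset_eq_image: "x <# A = (\<lambda>a. x \<otimes> a) ` A"
  by (auto simp: l_coset_def)

lemma l_coset_sym_diff:
  assumes "x \<in> carrier G" "A \<subseteq> carrier G" "B \<subseteq> carrier G"
  shows "x <# sym_diff A B = sym_diff (x <# A) (x <# B)"
proof -
  have inj: "inj_on (\<lambda>a. x \<otimes> a) (carrier G)"
    using assms(1) by (auto intro: inj_onI)
  show ?thesis
    unfolding l_coset_eq_image image_Un
    using assms by (subst (1 2) inj_on_image_set_diff[OF inj]) auto
qed

lemma group_C2_wreath: "group (C2_wreath G)"
proof (rule groupI)
  fix u v w
  assume "u \<in> carrier (C2_wreath G)" "v \<in> carrier (C2_wreath G)" "w \<in> carrier (C2_wreath G)"
  then obtain A x B y C z where uvw: "u = (A, x)" "v = (B, y)" "w = (C, z)"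
    and x: "x \<in> carrier G" "y \<in> carrier G" "z \<in> carrier G"
    and A: "A \<subseteq> carrier G" "B \<subseteq> carrier G" "C \<subseteq> carrier G"
    by auto
  have "x <# sym_diff B (y <# C) = sym_diff (x <# B) (x \<otimes> y <# C)"
    using x A by (simp add: l_coset_sym_diff l_coset_subset_G lcos_m_assoc)
  then show "u \<otimes>\<^bsub>C2_wreath G\<^esub> v \<otimes>\<^bsub>C2_wreath G\<^esub> w = u \<otimes>\<^bsub>C2_wreath G\<^esub> (v \<otimes>\<^bsub>C2_wreath G\<^esub> w)"
    using x by (simp add: uvw m_assoc) blast
next
  fix u assume "u \<in> carrier (C2_wreath G)"
  then obtain A x where u: "u = (A, x)" and x: "x \<in> carrier G" and A: "A \<subseteq> carrier G" by auto
  show "\<exists>v\<in>carrier (C2_wreath G). v \<otimes>\<^bsub>C2_wreath G\<^esub> u = \<one>\<^bsub>C2_wreath G\<^esub>"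
    using x A by (intro bexI[of _ "(inv x <# A, inv x)"]) (auto simp: u dest: l_coset_subset_G)
  show "\<one>\<^bsub>C2_wreath G\<^esub> \<otimes>\<^bsub>C2_wreath G\<^esub> u = u"
    using x A by (simp add: u lcos_mult_one)
qed (auto simp: l_coset_eq_image subset_iff)

lemma group_hom_snd_C2_wreath: "group_hom (C2_wreath G) G snd"
  using group_C2_wreath is_group by (auto simp: group_hom_def group_hom_axioms_def hom_def)

lemma kernel_snd_C2_wreath: "kernel (C2_wreath G) G snd = Pow (carrier G) \<times> {\<one>}"
  by (auto simp: kernel_def)

lemma snd_C2_wreath_surj: "snd ` carrier (C2_wreath G) = carrier G"
  by auto

lemma solvable_C2_wreath:
  assumes "solvable G"
  shows "solvable (C2_wreath G)"
proof -
  let ?P = "C2_wreath G"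
  let ?W = "?P\<lparr>carrier := Pow (carrier G) \<times> {\<one>}\<rparr>"
  interpret P: group ?P by (rule group_C2_wreath)
  interpret p: group_hom ?P G snd by (rule group_hom_snd_C2_wreath)
  have W: "group ?W"
    using P.subgroup_imp_group[OF p.subgroup_kernel] by (simp add: kernel_snd_C2_wreath)
  have "comm_group ?W"
    by (rule group.group_comm_groupI[OF W]) (auto simp: lcos_mult_one)
  then have "solvable ?W" by (rule comm_group.comm_group_imp_solvable)
  moreover have "group_hom ?W ?P (\<lambda>w. w)"
    using W P.is_group by (auto simp: group_hom_def group_hom_axioms_def hom_def)
  ultimately show ?thesis
    using assms group_hom_snd_C2_wreath
    by (intro solvable_condition[of ?W ?P "\<lambda>w. w" G snd])
      (simp_all only: snd_C2_wreath_surj kernel_snd_C2_wreath, auto)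
qed

text \<open>An element \<open>(A, x)\<close> that commutes with the singleton \<open>{\<one>}\<close> of the base group translates
  \<open>{\<one>}\<close> to itself, which forces \<open>x = \<one>\<close>.\<close>

lemma of_characteristic_C2_wreath:
  assumes fin: "finite (carrier G)"
  shows "of_characteristic 2 (C2_wreath G)"
proof (rule of_characteristicI)
  let ?P = "C2_wreath G" and ?W = "Pow (carrier G) \<times> {\<one>}"
  interpret p: group_hom ?P G snd by (rule group_hom_snd_C2_wreath)
  have "?W \<lhd> ?P" using p.normal_kernel by (simp add: kernel_snd_C2_wreath)
  moreover have "card ?W = 2 ^ card (carrier G)"
    using fin by (simp add: card_Pow card_cartesian_product)
  ultimately show "normal_q_subgroup 2 ?W ?P"
    by (auto simp: normal_q_subgroup_def)
  show "centralizer ?P ?W \<subseteq> ?W"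
  proof
    fix u assume u: "u \<in> centralizer ?P ?W"
    then obtain A x where Ax: "u = (A, x)" "x \<in> carrier G" "A \<subseteq> carrier G"
      by (auto simp: centralizer_def)
    have "({\<one>}, \<one>) \<in> ?W" by simp
    with u have "u \<otimes>\<^bsub>?P\<^esub> ({\<one>}, \<one>) = ({\<one>}, \<one>) \<otimes>\<^bsub>?P\<^esub> u"
      unfolding centralizer_def by blast
    then have "sym_diff A {x} = sym_diff {\<one>} A"
      using Ax l_coset_eq_image[of x "{\<one>}"] by (simp add: lcos_mult_one)
    then have "x = \<one>" by blast
    then show "u \<in> ?W" using Ax by simp
  qed
qed (use fin group_C2_wreath in auto)

text \<open>Taking images under an equivariant permutation \<open>f\<close> is an isomorphism between the power set
  with \<open>H\<close> acting by left translation and the power set with \<open>K\<close> acting by left translation,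
  compatible with \<open>\<phi>\<close>. It therefore combines with \<open>\<phi>\<close> to an isomorphism of the semidirect
  products.\<close>

lemma C2_wreath_vimage_iso:
  assumes fin: "finite (carrier G)" and H: "subgroup H G" and K: "subgroup K G"
    and "G\<lparr>carrier := H\<rparr> \<cong> G\<lparr>carrier := K\<rparr>"
  shows "(C2_wreath G)\<lparr>carrier := Pow (carrier G) \<times> H\<rparr>
    \<cong> (C2_wreath G)\<lparr>carrier := Pow (carrier G) \<times> K\<rparr>"
proof -
  obtain \<phi> where \<phi>: "\<phi> \<in> iso (G\<lparr>carrier := H\<rparr>) (G\<lparr>carrier := K\<rparr>)"
    using assms(4) by (auto simp: is_iso_def)
  then have \<phi>_bij: "bij_betw \<phi> H K" and \<phi>_mult: "\<And>a b. a \<in> H \<Longrightarrow> b \<in> H \<Longrightarrow> \<phi> (a \<otimes> b) = \<phi> a \<otimes> \<phi> b"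
    by (auto simp: iso_def hom_def)
  obtain f where f: "bij_betw f (carrier G) (carrier G)"
    and equiv: "\<And>h x. h \<in> H \<Longrightarrow> x \<in> carrier G \<Longrightarrow> f (h \<otimes> x) = \<phi> h \<otimes> f x"
    using ex_equivariant_bij[OF fin H K \<phi>] by blast
  have f_inj: "inj_on f (carrier G)" using f by (rule bij_betw_imp_inj_on)
  let ?F = "map_prod (image f) \<phi>"
  have bij: "bij_betw ?F (Pow (carrier G) \<times> H) (Pow (carrier G) \<times> K)"
    using bij_betw_map_prod[OF bij_betw_Pow[OF f] \<phi>_bij] .
  have mult: "?F ((A, h) \<otimes>\<^bsub>C2_wreath G\<^esub> (B, k)) = ?F (A, h) \<otimes>\<^bsub>C2_wreath G\<^esub> ?F (B, k)"
    if A: "A \<subseteq> carrier G" "B \<subseteq> carrier G" and h: "h \<in> H" "k \<in> H" for A h B k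
  proof -
    have sub: "h <# B \<subseteq> carrier G"
      using A h H by (simp add: l_coset_subset_G subgroup.mem_carrier)
    have "f ` sym_diff A (h <# B) = sym_diff (f ` A) (f ` (h <# B))"
      unfolding image_Un using A sub by (subst (1 2) inj_on_image_set_diff[OF f_inj]) auto
    also have "f ` (h <# B) = \<phi> h <# f ` B"
      unfolding l_coset_eq_image image_image using A h equiv by (intro image_cong) auto
    finally show ?thesis using h \<phi>_mult by simp
  qed
  have "?F \<in> iso ((C2_wreath G)\<lparr>carrier := Pow (carrier G) \<times> H\<rparr>)
    ((C2_wreath G)\<lparr>carrier := Pow (carrier G) \<times> K\<rparr>)"
  proof (rule isoI)
    show "?F \<in> hom ((C2_wreath G)\<lparr>carrier := Pow (carrier G) \<times> H\<rparr>)
      ((C2_wreath G)\<lparr>carrier := Pow (carrier G) \<times> K\<rparr>)"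
    proof (rule homI)
      fix u assume "u \<in> carrier ((C2_wreath G)\<lparr>carrier := Pow (carrier G) \<times> H\<rparr>)"
      then show "?F u \<in> carrier ((C2_wreath G)\<lparr>carrier := Pow (carrier G) \<times> K\<rparr>)"
        using bij_betwE[OF bij] by auto
    next
      fix u v
      assume "u \<in> carrier ((C2_wreath G)\<lparr>carrier := Pow (carrier G) \<times> H\<rparr>)"
        "v \<in> carrier ((C2_wreath G)\<lparr>carrier := Pow (carrier G) \<times> H\<rparr>)"
      then show "?F (u \<otimes>\<^bsub>(C2_wreath G)\<lparr>carrier := Pow (carrier G) \<times> H\<rparr>\<^esub> v)
        = ?F u \<otimes>\<^bsub>(C2_wreath G)\<lparr>carrier := Pow (carrier G) \<times> K\<rparr>\<^esub> ?F v"
        using mult by (cases u; cases v) (simp del: C2_wreath_simps map_prod_simp)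
    qed
  qed (use bij in simp)
  then show ?thesis by (auto simp: is_iso_def)
qed

lemma vimage_snd_C2_wreath:
  assumes "subgroup S G"
  shows "{u \<in> carrier (C2_wreath G). snd u \<in> S} = Pow (carrier G) \<times> S"
  using subgroup.subset[OF assms] by auto

lemma maximal_subgroup_C2_wreath_iff:
  assumes S: "subgroup S G"
  shows "maximal_subgroup (Pow (carrier G) \<times> S) (C2_wreath G) \<longleftrightarrow> maximal_subgroup S G"
  using group_hom.maximal_subgroup_vimage_iff[OF group_hom_snd_C2_wreath snd_C2_wreath_surj S]
  unfolding vimage_snd_C2_wreath[OF S] .

lemma subgroup_C2_wreath:
  assumes S: "subgroup S G"
  shows "subgroup (Pow (carrier G) \<times> S) (C2_wreath G)"
  using group_hom.subgroup_vimage[OF group_hom_snd_C2_wreath S]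
  unfolding vimage_snd_C2_wreath[OF S] .

end

section \<open>The reduction\<close>

theorem theoremA:
  assumes "\<forall>q::nat. Factorial_Ring.prime q \<longrightarrow>
    (\<forall>G :: nat monoid. group G \<and> finite (carrier G) \<and> solvable G \<and> of_characteristic q G \<longrightarrow>
      (\<forall>H K. maximal_subgroup H G \<and> subgroup K G \<and> G\<lparr>carrier := K\<rparr> \<cong> G\<lparr>carrier := H\<rparr> \<longrightarrow>
        maximal_subgroup K G))"
  shows "\<forall>G :: 'a monoid. group G \<and> finite (carrier G) \<and> solvable G \<longrightarrow>
      (\<forall>H K. maximal_subgroup H G \<and> subgroup K G \<and> G\<lparr>carrier := K\<rparr> \<cong> G\<lparr>carrier := H\<rparr> \<longrightarrow>
        maximal_subgroup K G)"
proof (intro allI impI, elim conjE)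
  fix G :: "'a monoid" and H K
  assume G: "group G" "finite (carrier G)" "solvable G" and H: "maximal_subgroup H G"
    and K: "subgroup K G" and iso: "G\<lparr>carrier := K\<rparr> \<cong> G\<lparr>carrier := H\<rparr>"
  interpret group G by fact
  have sH: "subgroup H G" using H by (simp add: maximal_subgroup_def)
  have "maximal_subgroup (Pow (carrier G) \<times> K) (C2_wreath G)"
  proof (rule nat_groups_suffice[where q = 2 and H = "Pow (carrier G) \<times> H"])
    show "maximal_subgroup (Pow (carrier G) \<times> H) (C2_wreath G)"
      using maximal_subgroup_C2_wreath_iff[OF sH] H by simp
    show "(C2_wreath G)\<lparr>carrier := Pow (carrier G) \<times> K\<rparr>
      \<cong> (C2_wreath G)\<lparr>carrier := Pow (carrier G) \<times> H\<rparr>"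
      using C2_wreath_vimage_iso[OF G(2) K sH iso] .
    show "maximal_subgroup K' G'"
      if "group G'" "finite (carrier G')" "solvable G'" "of_characteristic 2 G'"
        "maximal_subgroup H' G'" "subgroup K' G'" "G'\<lparr>carrier := K'\<rparr> \<cong> G'\<lparr>carrier := H'\<rparr>"
      for G' :: "nat monoid" and H' K'
      using assms two_is_prime_nat that by blast
  qed (use two_is_prime_nat G K group_C2_wreath solvable_C2_wreath
      of_characteristic_C2_wreath subgroup_C2_wreath in auto)
  then show "maximal_subgroup K G"
    using maximal_subgroup_C2_wreath_iff[OF K] by simp
qed

end
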